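(* Let $\zeta(3)=\sum_{n=1}^{\infty} n^{-3}$. Then $$2\zeta(3)=b^{(1)}_0+\frac{a^{(1)}_1\vert}{\vert b^{(1)}_1}+\frac{a^{(1)}_2\vert}{\vert b^{(1)}_2}+\cdots+\frac{a^{(1)}_\nu\vert}{\vert b^{(1)}_\nu}+\cdots$$ and $$2\zeta(3)=b^{(2)}_0+\frac{a^{(2)}_1\vert}{\vert b^{(2)}_1}+\frac{a^{(2)}_2\vert}{\vert b^{(2)}_2}+\cdots+\frac{a^{(2)}_\nu\vert}{\vert b^{(2)}_\nu}+\cdots,$$ where $b^{(1)}_0=3$, $a^{(1)}_1=-81$, $a^{(1)}_\nu=-(\nu-1)^3\nu^3(4\nu^2-4\nu-3)^3$ for integers $\nu\ge 2$, and $b^{(1)}_\nu=4(68\nu^6-45\nu^4+12\nu^2-1)$ for integers $\nu\ge1$; and $b^{(2)}_0=2$, $a^{(2)}_1=42$, $a^{(2)}_\nu=-(\nu-1)^3\nu^3(4\nu^2-4\nu-3)\big((\nu+1)^3-\nu^3\big)\big((\nu-1)^3-(\nu-2)^3\big)$ for integers $\nu\ge2$, and $b^{(2)}_\nu=2(102\nu^6-68\nu^4+21\nu^2-3)$ for integers $\nu\ge1$.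
   Context: For sequences $(b_\nu)_{\nu\ge0}$ and $(a_\nu)_{\nu\ge1}$, the continued fraction $b_0+\frac{a_1\vert}{\vert b_1}+\frac{a_2\vert}{\vert b_2}+\cdots$ denotes $b_0+\cfrac{a_1}{b_1+\cfrac{a_2}{b_2+\cdots}}$, i.e. the limit as $\nu\to\infty$ of the convergents $P_\nu/Q_\nu$, where $P_\nu,Q_\nu$ satisfy $x_{\nu+1}=b_{\nu+1}x_\nu+a_{\nu+1}x_{\nu-1}$ for $\nu\ge0$ with $P_{-1}=1$, $Q_{-1}=0$, $P_0=b_0$, $Q_0=1$. The claim asserts that these convergents (well defined, i.e. with nonzero denominators) converge to $2\zeta(3)$. *)

theory Defs
  imports "HOL-Analysis.Analysis"
begin

definition zeta3 :: real where
  "zeta3 = (\<Sum>n. 1 / real (Suc n) ^ 3)"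

lemma zeta3_sums: "(\<lambda>n. 1 / real (Suc n) ^ 3) sums zeta3"
proof -
  have "summable (\<lambda>n. inverse (real n ^ 3))"
    by (rule inverse_power_summable) simp
  then have "summable (\<lambda>n. inverse (real (Suc n) ^ 3))"
    by (subst summable_Suc_iff)
  then show ?thesis
    unfolding zeta3_def by (simp add: field_simps summable_sums)
qed

text \<open>
  The solution \<open>x\<close> of \<open>x\<^bsub>\<nu>+1\<^esub> = b\<^bsub>\<nu>+1\<^esub> x\<^bsub>\<nu>\<^esub> + a\<^bsub>\<nu>+1\<^esub> x\<^bsub>\<nu>-1\<^esub>\<close> (\<open>\<nu> \<ge> 0\<close>) with initial
  values \<open>x\<^bsub>-1\<^esub> = u\<close> and \<open>x\<^bsub>0\<^esub> = v\<close>, restricted to indices \<open>\<ge> 0\<close>. The value \<open>a 0\<close> is never used.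
\<close>
fun cf_rec :: "(nat \<Rightarrow> real) \<Rightarrow> (nat \<Rightarrow> real) \<Rightarrow> real \<Rightarrow> real \<Rightarrow> nat \<Rightarrow> real" where
  "cf_rec b a u v 0 = v"
| "cf_rec b a u v (Suc 0) = b 1 * v + a 1 * u"
| "cf_rec b a u v (Suc (Suc n)) =
     b (Suc (Suc n)) * cf_rec b a u v (Suc n) + a (Suc (Suc n)) * cf_rec b a u v n"

definition cf_num :: "(nat \<Rightarrow> real) \<Rightarrow> (nat \<Rightarrow> real) \<Rightarrow> nat \<Rightarrow> real" where
  "cf_num b a = cf_rec b a 1 (b 0)"

definition cf_den :: "(nat \<Rightarrow> real) \<Rightarrow> (nat \<Rightarrow> real) \<Rightarrow> nat \<Rightarrow> real" where
  "cf_den b a = cf_rec b a 0 1"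

definition has_cf_value :: "(nat \<Rightarrow> real) \<Rightarrow> (nat \<Rightarrow> real) \<Rightarrow> real \<Rightarrow> bool" where
  "has_cf_value b a L \<longleftrightarrow>
     (\<forall>\<nu>. cf_den b a \<nu> \<noteq> 0) \<and> (\<lambda>\<nu>. cf_num b a \<nu> / cf_den b a \<nu>) \<longlonglongrightarrow> L"

definition b1 :: "nat \<Rightarrow> real" where
  "b1 \<nu> = (if \<nu> = 0 then 3
           else 4 * (68 * real \<nu> ^ 6 - 45 * real \<nu> ^ 4 + 12 * real \<nu> ^ 2 - 1))"

definition a1 :: "nat \<Rightarrow> real" where
  "a1 \<nu> = (if \<nu> = 1 then -81
           else - ((real \<nu> - 1) ^ 3 * real \<nu> ^ 3 * (4 * real \<nu> ^ 2 - 4 * real \<nu> - 3) ^ 3))"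

definition b2 :: "nat \<Rightarrow> real" where
  "b2 \<nu> = (if \<nu> = 0 then 2
           else 2 * (102 * real \<nu> ^ 6 - 68 * real \<nu> ^ 4 + 21 * real \<nu> ^ 2 - 3))"

definition a2 :: "nat \<Rightarrow> real" where
  "a2 \<nu> = (if \<nu> = 1 then 42
           else - ((real \<nu> - 1) ^ 3 * real \<nu> ^ 3 * (4 * real \<nu> ^ 2 - 4 * real \<nu> - 3)
                   * ((real \<nu> + 1) ^ 3 - real \<nu> ^ 3)
                   * ((real \<nu> - 1) ^ 3 - (real \<nu> - 2) ^ 3)))"

end

theory Submission
  imports Defs "HOL-Real_Asymp.Real_Asymp"
begin

text \<open>
  Let \<open>U\<close> solve Apery's recurrence
  \<open>(n+1)\<^sup>3 U\<^bsub>n+1\<^esub> = (34n\<^sup>3 + 51n\<^sup>2 + 27n + 5) U\<^bsub>n\<^esub> - n\<^sup>3 U\<^bsub>n-1\<^esub>\<close>. Then the combinations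
  \<open>U\<^bsub>n+1\<^esub> + s U\<^bsub>n\<^esub>\<close> solve a three-term recurrence too, and, multiplied by suitable products, the
  recurrence of a continued fraction: the first one for \<open>s = -1\<close> and the second one for \<open>s = 1\<close>.
  The denominators \<open>Q\<^bsub>n\<^esub>\<close> arise from the Apery numbers, which grow at least like \<open>5\<^sup>n\<close>. The errors
  \<open>2\<zeta>(3) Q\<^bsub>n\<^esub> - P\<^bsub>n\<^esub>\<close> arise from Ball's very-well-poised series
  \<open>S\<^bsub>n\<^esub> = \<Sum>\<^bsub>t\<ge>1\<^esub> n!\<^sup>2 (2t+n) (t-1)\<cdots>(t-n) (t+n+1)\<cdots>(t+2n) / (t(t+1)\<cdots>(t+n))\<^sup>4\<close>, which is bounded, has
  \<open>S\<^bsub>0\<^esub> = 2\<zeta>(3)\<close> and \<open>S\<^bsub>1\<^esub> = 10\<zeta>(3) - 12\<close>, and solves Apery's recurrence by creative telescoping.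
\<close>

section \<open>Continued fractions and three-term recurrences\<close>

lemma cf_rec_rescaled:
  assumes rec: "\<And>n. p (n + 1) * X (n + 2) = b (n + 2) * X (n + 1) - q n * X n"
    and a: "\<And>n. a (n + 2) = - (p n * q n)"
    and init: "c * X 0 = v" "c * p 0 * X 1 = b 1 * v + a 1 * u"
  shows "cf_rec b a u v n = c * (\<Prod>i<n. p i) * X n"
proof (induction n rule: induct_nat_012)
  case (ge2 n)
  have "cf_rec b a u v (n + 2)
      = b (n + 2) * (c * (\<Prod>i<n + 1. p i) * X (n + 1)) + a (n + 2) * (c * (\<Prod>i<n. p i) * X n)"
    using ge2 by simp
  also have "\<dots> = c * (\<Prod>i<n. p i) * p n * (b (n + 2) * X (n + 1) - q n * X n)"
    unfolding a by (simp add: algebra_simps)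
  also have "\<dots> = c * (\<Prod>i<n. p i) * p n * (p (n + 1) * X (n + 2))"
    by (simp only: rec)
  finally show ?case by (simp add: mult_ac)
qed (use init in simp_all)

lemma has_cf_value_rescaled:
  assumes N_rec: "\<And>n. p (n + 1) * N (n + 2) = b (n + 2) * N (n + 1) - q n * N n"
    and D_rec: "\<And>n. p (n + 1) * D (n + 2) = b (n + 2) * D (n + 1) - q n * D n"
    and a: "\<And>n. a (n + 2) = - (p n * q n)"
    and N_init: "N 0 = b 0 * D 0" "p 0 * N 1 = b 1 * N 0 + a 1 * D 0"
    and D_init: "p 0 * D 1 = b 1 * D 0"
    and nonzero: "\<And>n. p n \<noteq> 0" "\<And>n. D n \<noteq> 0"
    and lim: "(\<lambda>n. N n / D n) \<longlonglongrightarrow> L"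
  shows "has_cf_value b a L"
proof -
  define c where "c n = 1 / D 0 * (\<Prod>i<n. p i)" for n
  have c: "c n \<noteq> 0" for n
    using nonzero by (simp add: c_def)
  have den: "cf_den b a n = c n * D n" for n
    unfolding cf_den_def c_def
    by (rule cf_rec_rescaled[OF D_rec a]) (use D_init nonzero(2)[of 0] in \<open>simp_all add: field_simps\<close>)
  have num: "cf_num b a n = c n * N n" for n
    unfolding cf_num_def c_def
    by (rule cf_rec_rescaled[OF N_rec a]) (use N_init nonzero(2)[of 0] in \<open>simp_all add: field_simps\<close>)
  show ?thesis
    unfolding has_cf_value_def den num using c nonzero(2) lim by simp
qed

section \<open>Apery's recurrence\<close>

definition apery_coeff :: "real \<Rightarrow> real" where
  "apery_coeff x = 34 * x ^ 3 + 51 * x ^ 2 + 27 * x + 5"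

definition apery_solution :: "(nat \<Rightarrow> real) \<Rightarrow> bool" where
  "apery_solution U \<longleftrightarrow> (\<forall>n. (real n + 2) ^ 3 * U (n + 2)
     = apery_coeff (real n + 1) * U (n + 1) - (real n + 1) ^ 3 * U n)"

lemma apery_solutionD:
  assumes "apery_solution U"
  shows "(real n + 2) ^ 3 * U (n + 2) = apery_coeff (real n + 1) * U (n + 1) - (real n + 1) ^ 3 * U n"
  using assms unfolding apery_solution_def by blast

lemma apery_solution_mult_diff:
  assumes "apery_solution U" "apery_solution V"
  shows "apery_solution (\<lambda>n. c * U n - V n)"
  unfolding apery_solution_def
proof
  fix n
  show "(real n + 2) ^ 3 * (c * U (n + 2) - V (n + 2))
      = apery_coeff (real n + 1) * (c * U (n + 1) - V (n + 1)) - (real n + 1) ^ 3 * (c * U n - V n)"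
    using apery_solutionD[OF assms(1), of n] apery_solutionD[OF assms(2), of n] by algebra
qed

lemma apery_solution_unique:
  assumes "apery_solution U" "apery_solution V" and "U 0 = V 0" "U 1 = V 1"
  shows "U n = V n"
proof (induction n rule: induct_nat_012)
  case (ge2 n)
  have "(real n + 2) ^ 3 * U (n + 2) = (real n + 2) ^ 3 * V (n + 2)"
    using ge2 by (simp add: apery_solutionD[OF assms(1), simplified] apery_solutionD[OF assms(2), simplified])
  then show ?case by (simp add: add_eq_0_iff)
qed (use assms(3,4) in simp_all)

lemma apery_solution_growth:
  assumes U: "apery_solution U" and init: "0 < U 0" "5 * U 0 \<le> U 1"
  shows "0 < U n \<and> 5 * U n \<le> U (n + 1)"
proof (induction n)
  case 0
  show ?case using init by simp
next
  case (Suc n)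
  define x where "x = real n + 1"
  have x: "x > 0" by (simp add: x_def)
  have pos: "0 < U (n + 1)" and mono: "U n \<le> U (n + 1)" using Suc by auto
  have "apery_coeff x - x ^ 3 - 5 * (x + 1) ^ 3 = 28 * x ^ 3 + 36 * x ^ 2 + 12 * x"
    unfolding apery_coeff_def by algebra
  also have "\<dots> \<ge> 0" using x by simp
  finally have "5 * (x + 1) ^ 3 * U (n + 1) \<le> (apery_coeff x - x ^ 3) * U (n + 1)"
    using pos by (intro mult_right_mono) auto
  also have "\<dots> \<le> apery_coeff x * U (n + 1) - x ^ 3 * U n"
    using mult_left_mono[OF mono, of "x ^ 3"] x by (simp add: left_diff_distrib)
  also have "\<dots> = (x + 1) ^ 3 * U (n + 2)"
    using apery_solutionD[OF U, of n] by (simp add: x_def add_ac)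
  finally have "(x + 1) ^ 3 * (5 * U (n + 1)) \<le> (x + 1) ^ 3 * U (n + 2)"
    by (simp only: mult_ac)
  then show ?case using x pos by simp
qed

lemma apery_solution_ge_power:
  assumes "apery_solution U" "0 < U 0" "5 * U 0 \<le> U 1"
  shows "5 ^ n * U 0 \<le> U n"
proof (induction n)
  case (Suc n)
  then show ?case using apery_solution_growth[OF assms, of n] by simp
qed simp

fun apery_rec :: "real \<Rightarrow> real \<Rightarrow> nat \<Rightarrow> real" where
  "apery_rec u v 0 = u"
| "apery_rec u v (Suc 0) = v"
| "apery_rec u v (Suc (Suc n)) =
     (apery_coeff (real n + 1) * apery_rec u v (Suc n) - (real n + 1) ^ 3 * apery_rec u v n)
       / (real n + 2) ^ 3"

lemma apery_solution_apery_rec: "apery_solution (apery_rec u v)"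
  unfolding apery_solution_def by (simp add: add_eq_0_iff)

definition apery_den :: "nat \<Rightarrow> real" where
  "apery_den = apery_rec 1 5"

\<comment> \<open>Twice the usual numerators, because the target is \<open>2\<zeta>(3)\<close>.\<close>
definition apery_num :: "nat \<Rightarrow> real" where
  "apery_num = apery_rec 0 12"

lemma apery_solution_den: "apery_solution apery_den"
  unfolding apery_den_def by (rule apery_solution_apery_rec)

lemma apery_solution_num: "apery_solution apery_num"
  unfolding apery_num_def by (rule apery_solution_apery_rec)

lemma apery_den_simps: "apery_den 0 = 1" "apery_den 1 = 5" "apery_den 2 = 73"
  by (simp_all add: apery_den_def numeral_2_eq_2 apery_coeff_def)

lemma apery_num_simps: "apery_num 0 = 0" "apery_num 1 = 12" "apery_num 2 = 351 / 2"
  by (simp_all add: apery_num_def numeral_2_eq_2 apery_coeff_def)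

lemma apery_den_growth: "0 < apery_den n" "5 * apery_den n \<le> apery_den (n + 1)"
  using apery_solution_growth[OF apery_solution_den, of n] by (simp_all add: apery_den_simps[simplified])

lemma apery_den_ge_power: "5 ^ n \<le> apery_den n"
  using apery_solution_ge_power[OF apery_solution_den, of n] by (simp add: apery_den_simps[simplified])

section \<open>Ball's series for the Apery remainders\<close>

definition ball_ratio :: "real \<Rightarrow> real \<Rightarrow> real" where
  "ball_ratio x t = (x + 1)\<^sup>2 * (t - x - 1) * (t + 2 * x + 1) * (t + 2 * x + 2) / (t + x + 1) ^ 5"

\<comment> \<open>The summand of Ball's series without the factor \<open>2t + n\<close>.\<close>
definition ball_core :: "nat \<Rightarrow> real \<Rightarrow> real" where
  "ball_core n t = (\<Prod>i<n. ball_ratio (real i) t) / t ^ 4"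

lemma ball_core_0: "ball_core 0 t = 1 / t ^ 4"
  by (simp add: ball_core_def)

lemma ball_core_Suc: "ball_core (Suc n) t = ball_core n t * ball_ratio (real n) t"
  by (simp add: ball_core_def)

lemma ball_core_shift:
  assumes "t > 0"
  shows "(t - real m) * ball_core m (t + 1)
    = t ^ 5 * (t + 2 * real m + 1) * ball_core m t / (t + real m + 1) ^ 5"
proof (induction m)
  case 0
  show ?case using assms by (simp add: ball_core_0 divide_simps) algebra
next
  case (Suc m)
  define x where "x = real m"
  have "(t - real (Suc m)) * ball_core (Suc m) (t + 1)
      = ((t - x) * ball_core m (t + 1))
        * ((t - x - 1) * (x + 1)\<^sup>2 * (t + 2 * x + 2) * (t + 2 * x + 3) / (t + x + 2) ^ 5)"
    by (simp add: x_def ball_core_Suc ball_ratio_def algebra_simps)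
  also have "(t - x) * ball_core m (t + 1) = t ^ 5 * (t + 2 * x + 1) * ball_core m t / (t + x + 1) ^ 5"
    using Suc.IH by (simp add: x_def)
  finally show ?case
    by (simp add: x_def ball_core_Suc ball_ratio_def add_ac mult_ac)
qed

lemma ball_core_eq_0:
  assumes "k < n"
  shows "ball_core n (real (Suc k)) = 0"
proof -
  have "ball_ratio (real k) (real (Suc k)) = 0" by (simp add: ball_ratio_def)
  with assms have "(\<Prod>i<n. ball_ratio (real i) (real (Suc k))) = 0" by (intro prod_zero) auto
  then show ?thesis by (simp only: ball_core_def div_0)
qed

lemma ball_ratio_bounds:
  assumes "0 \<le> x" "x + 1 \<le> t"
  shows "0 \<le> ball_ratio x t" "ball_ratio x t \<le> 1"
proof -
  show "0 \<le> ball_ratio x t"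
    using assms by (simp add: ball_ratio_def)
  have "4 * ((x + 1)\<^sup>2 * (t - x - 1) * (t + 2 * x + 1) * (t + 2 * x + 2))
      = (2 * (x + 1))\<^sup>2 * (t - x - 1) * (t + 2 * x + 1) * (t + 2 * x + 2)"
    by algebra
  also have "\<dots> \<le> (t + x + 1)\<^sup>2 * (t + x + 1) * (2 * (t + x + 1)) * (2 * (t + x + 1))"
    using assms by (intro mult_mono power_mono mult_nonneg_nonneg) auto
  also have "\<dots> = 4 * (t + x + 1) ^ 5" by algebra
  finally have "(x + 1)\<^sup>2 * (t - x - 1) * (t + 2 * x + 1) * (t + 2 * x + 2) \<le> (t + x + 1) ^ 5"
    by linarith
  then show "ball_ratio x t \<le> 1"
    using assms by (simp add: ball_ratio_def)
qed

lemma abs_ball_core_le: "\<bar>ball_core n (real (Suc k))\<bar> \<le> 1 / real (Suc k) ^ 4"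
proof (cases "k < n")
  case True
  then show ?thesis by (simp only: ball_core_eq_0) simp
next
  case False
  then have "0 \<le> ball_ratio (real i) (real (Suc k)) \<and> ball_ratio (real i) (real (Suc k)) \<le> 1"
    if "i < n" for i
    using that by (auto intro!: ball_ratio_bounds)
  then have "0 \<le> (\<Prod>i<n. ball_ratio (real i) (real (Suc k)))"
    and "(\<Prod>i<n. ball_ratio (real i) (real (Suc k))) \<le> 1"
    by (auto intro!: prod_nonneg prod_le_1)
  then show ?thesis
    by (simp only: ball_core_def abs_divide abs_of_nonneg) (simp add: divide_right_mono)
qed

definition ball_term :: "nat \<Rightarrow> nat \<Rightarrow> real" where
  "ball_term n k = (2 * real (Suc k) + real n) * ball_core n (real (Suc k))"

definition ball_sum :: "nat \<Rightarrow> real" where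
  "ball_sum n = (\<Sum>k. ball_term n k)"

lemma abs_ball_term_le: "\<bar>ball_term n k\<bar> \<le> 3 * (1 / real (Suc k) ^ 3)"
proof (cases "k < n")
  case True
  then show ?thesis by (simp only: ball_term_def ball_core_eq_0) simp
next
  case False
  define t where "t = real (Suc k)"
  have t: "real n \<le> t" "t > 0" using False by (auto simp: t_def)
  have "\<bar>2 * t + real n\<bar> * \<bar>ball_core n t\<bar> \<le> (3 * t) * (1 / t ^ 4)"
    using t abs_ball_core_le[of n k] by (intro mult_mono) (auto simp: t_def)
  also have "\<dots> = 3 * (1 / t ^ 3)"
    using t by (simp add: eval_nat_numeral)
  finally show ?thesis
    by (simp add: ball_term_def t_def abs_mult)
qed

lemma summable_abs_ball_term: "summable (\<lambda>k. \<bar>ball_term n k\<bar>)"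
proof (rule summable_comparison_test')
  show "summable (\<lambda>k. 3 * (1 / real (Suc k) ^ 3))"
    by (intro summable_mult sums_summable[OF zeta3_sums])
  show "norm \<bar>ball_term n k\<bar> \<le> 3 * (1 / real (Suc k) ^ 3)" for k
    unfolding real_norm_def abs_abs by (rule abs_ball_term_le)
qed

lemma ball_term_sums: "ball_term n sums ball_sum n"
  unfolding ball_sum_def
  by (rule summable_sums[OF summable_rabs_cancel[OF summable_abs_ball_term]])

lemma abs_ball_sum_le: "\<bar>ball_sum n\<bar> \<le> 3 * zeta3"
proof -
  have "\<bar>ball_sum n\<bar> \<le> (\<Sum>k. \<bar>ball_term n k\<bar>)"
    unfolding ball_sum_def by (rule summable_rabs[OF summable_abs_ball_term])
  also have "\<dots> \<le> 3 * zeta3"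
    by (rule sums_le[OF abs_ball_term_le summable_sums[OF summable_abs_ball_term]
          sums_mult[OF zeta3_sums]])
  finally show ?thesis .
qed

lemma ball_sum_0: "ball_sum 0 = 2 * zeta3"
proof -
  have "ball_term 0 k = 2 * (1 / real (Suc k) ^ 3)" for k
  proof -
    define t where "t = real (Suc k)"
    have "t > 0" by (simp add: t_def)
    then have "2 * t * (1 / t ^ 4) = 2 * (1 / t ^ 3)" by (simp add: eval_nat_numeral)
    then show ?thesis by (simp add: ball_term_def ball_core_0 t_def)
  qed
  then have "ball_term 0 sums (2 * zeta3)"
    using sums_mult[OF zeta3_sums, of 2] by presburger
  then show ?thesis using ball_term_sums sums_unique2 by blast
qed

lemma ball_sum_1: "ball_sum 1 = 10 * zeta3 - 12"
proof -
  define g :: "real \<Rightarrow> real" where "g t = (- (t ^ 4) + 5 * t ^ 2 + 5 * t + 2) / t ^ 4" for t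
  have "(\<lambda>k. g (real (Suc k))) \<longlonglongrightarrow> -1"
    unfolding g_def by real_asymp
  then have "(\<lambda>k. g (real (Suc (Suc k))) - g (real (Suc k))) sums (-1 - g (real (Suc 0)))"
    by (rule telescope_sums)
  moreover have "g (real (Suc (Suc k))) - g (real (Suc k)) = ball_term 1 k - 5 * ball_term 0 k" for k
  proof -
    define t where "t = real (Suc k)"
    have t: "t > 0" "t + 1 > 0" by (simp_all add: t_def)
    have "g (t + 1) - g t
        = (2 * t + 1) * (1 / t ^ 4 * ((t - 1) * (t + 1) * (t + 2) / (t + 1) ^ 5)) - 5 * (2 * t * (1 / t ^ 4))"
      unfolding g_def using t by (simp add: divide_simps) algebra
    then show ?thesis
      by (simp add: ball_term_def ball_core_Suc ball_core_0 ball_ratio_def t_def add_ac)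
  qed
  ultimately have "(\<lambda>k. ball_term 1 k - 5 * ball_term 0 k) sums (-12)"
    by (simp add: g_def)
  moreover have "(\<lambda>k. ball_term 1 k - 5 * ball_term 0 k) sums (ball_sum 1 - 5 * ball_sum 0)"
    by (intro sums_diff sums_mult ball_term_sums)
  ultimately have "ball_sum 1 - 5 * ball_sum 0 = -12" by (rule sums_unique2[symmetric])
  then show ?thesis by (simp add: ball_sum_0)
qed

section \<open>Creative telescoping for Ball's series\<close>

text \<open>
  The telescoping certificate is due to W. Zudilin, "An elementary proof of Apery's theorem".
\<close>
definition zudilin_poly :: "real \<Rightarrow> real \<Rightarrow> real" where
  "zudilin_poly n t =
     - (t ^ 6) - (8 * n - 1) * t ^ 5 + (4 * n ^ 2 + 27 * n + 5) * t ^ 4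
     + 2 * n * (67 * n ^ 2 + 71 * n + 15) * t ^ 3
     + (358 * n ^ 4 + 339 * n ^ 3 + 76 * n ^ 2 - 7 * n - 3) * t ^ 2
     + (384 * n ^ 5 + 396 * n ^ 4 + 97 * n ^ 3 - 29 * n ^ 2 - 17 * n - 2) * t
     + n * (153 * n ^ 5 + 183 * n ^ 4 + 50 * n ^ 3 - 30 * n ^ 2 - 22 * n - 4)"

lemma zudilin_poly_identity:
  "(n + 1) ^ 5 * (2 * u - n + 1) * ((u - 2 * n) * (u + n - 1) * (u + n))
      * ((u - 2 * n - 1) * (u + n + 1) * (u + n + 2))
    - apery_coeff n * (2 * u - n) * ((u - 2 * n) * (u + n - 1) * (u + n)) * (u + 1) ^ 5
    + n * (2 * u - n - 1) * u ^ 5 * (u + 1) ^ 5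
  = (u - n) ^ 5 * (u + n - 1) * zudilin_poly n (u - n + 1)
    - (u - 2 * n) * zudilin_poly n (u - n) * (u + 1) ^ 5"
  unfolding zudilin_poly_def apery_coeff_def by algebra

lemma zudilin_poly_tendsto: "((\<lambda>t. zudilin_poly n t / t ^ 6) \<longlongrightarrow> -1) at_top"
  unfolding zudilin_poly_def by real_asymp

definition zudilin_cert :: "nat \<Rightarrow> real \<Rightarrow> real" where
  "zudilin_cert m t = (real m + 1)\<^sup>2 * (t - real m - 1) * zudilin_poly (real m + 1) t
     / (t + real m + 1) ^ 5 * ball_core m t"

lemma zudilin_cert_shift:
  assumes "t > 0"
  shows "zudilin_cert m (t + 1) = (real m + 1)\<^sup>2 * zudilin_poly (real m + 1) (t + 1) / (t + real m + 2) ^ 5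
    * (t ^ 5 * (t + 2 * real m + 1) * ball_core m t / (t + real m + 1) ^ 5)"
  unfolding ball_core_shift[OF assms, symmetric] by (simp add: zudilin_cert_def add_ac)

lemma zudilin_cert_diff:
  assumes "t > 0"
  shows "zudilin_cert m (t + 1) - zudilin_cert m t =
    (real m + 2) ^ 3 * ((2 * t + real m + 2) * ball_core (m + 2) t)
    - apery_coeff (real m + 1) * ((2 * t + real m + 1) * ball_core (m + 1) t)
    + (real m + 1) ^ 3 * ((2 * t + real m) * ball_core m t)"
proof -
  define n u K where "n = real m + 1" and "u = t + n" and "K = ball_core m t / (u ^ 5 * (u + 1) ^ 5)"
  have m: "real m = n - 1" and t: "t = u - n" by (simp_all add: n_def u_def)
  have pos: "u > 0" "u + 1 > 0" using assms by (simp_all add: u_def n_def)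
  have core0: "ball_core m t = K * u ^ 5 * (u + 1) ^ 5"
    using pos by (simp add: K_def)
  have ratio: "ball_ratio (real m) t = n\<^sup>2 * ((u - 2 * n) * (u + n - 1) * (u + n)) / u ^ 5"
    "ball_ratio (real m + 1) t = (n + 1)\<^sup>2 * ((u - 2 * n - 1) * (u + n + 1) * (u + n + 2)) / (u + 1) ^ 5"
    by (simp_all add: ball_ratio_def m t algebra_simps)
  have "ball_core (m + 1) t = ball_core m t * ball_ratio (real m) t"
    "ball_core (m + 2) t = ball_core m t * ball_ratio (real m) t * ball_ratio (real m + 1) t"
    by (simp_all add: ball_core_Suc numeral_2_eq_2 add_ac)
  then have core: "ball_core (m + 1) t = K * n\<^sup>2 * ((u - 2 * n) * (u + n - 1) * (u + n)) * (u + 1) ^ 5"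
    "ball_core (m + 2) t = K * n\<^sup>2 * (n + 1)\<^sup>2
      * ((u - 2 * n) * (u + n - 1) * (u + n)) * ((u - 2 * n - 1) * (u + n + 1) * (u + n + 2))"
    unfolding core0 ratio using pos by simp_all
  have cert0: "zudilin_cert m t = K * n\<^sup>2 * (u - 2 * n) * zudilin_poly n (u - n) * (u + 1) ^ 5"
    unfolding zudilin_cert_def core0 using pos by (simp add: m t)
  have cert1: "zudilin_cert m (t + 1) = K * n\<^sup>2 * (u - n) ^ 5 * (u + n - 1) * zudilin_poly n (u - n + 1)"
    unfolding zudilin_cert_shift[OF assms] core0 using pos by (simp add: m t add.commute[of _ u])
  have "zudilin_cert m (t + 1) - zudilin_cert m t = K * n\<^sup>2 *
      ((u - n) ^ 5 * (u + n - 1) * zudilin_poly n (u - n + 1)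
        - (u - 2 * n) * zudilin_poly n (u - n) * (u + 1) ^ 5)"
    unfolding cert0 cert1 by algebra
  also have "\<dots> = (n + 1) ^ 3 * ((2 * u - n + 1) * ball_core (m + 2) t)
      - apery_coeff n * ((2 * u - n) * ball_core (m + 1) t) + n ^ 3 * ((2 * u - n - 1) * ball_core m t)"
    unfolding zudilin_poly_identity[symmetric] core0 core by algebra
  finally show ?thesis
    by (simp add: n_def u_def add_ac)
qed

lemma zudilin_cert_1: "zudilin_cert m 1 = 0"
proof (cases m)
  case (Suc k)
  then have "ball_core m 1 = 0" using ball_core_eq_0[of 0 m] by simp
  then show ?thesis by (simp only: zudilin_cert_def mult_zero_right)
qed (simp add: zudilin_cert_def)

lemma zudilin_cert_tendsto_0: "(\<lambda>k. zudilin_cert m (real (Suc k))) \<longlonglongrightarrow> 0"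
proof (rule Lim_null_comparison)
  define n where "n = real m + 1"
  define f where "f t = n\<^sup>2 * ((t - n) * t ^ 2 / (t + n) ^ 5) * (zudilin_poly n t / t ^ 6)" for t
  have "((\<lambda>t. (t - n) * t ^ 2 / (t + n) ^ 5) \<longlongrightarrow> 0) at_top"
    by real_asymp
  then have "((\<lambda>t. \<bar>f t\<bar>) \<longlongrightarrow> \<bar>n\<^sup>2 * 0 * -1\<bar>) at_top"
    unfolding f_def by (intro tendsto_intros zudilin_poly_tendsto)
  moreover have "filterlim (\<lambda>k. real (Suc k)) at_top sequentially"
    by real_asymp
  ultimately show "(\<lambda>k. \<bar>f (real (Suc k))\<bar>) \<longlonglongrightarrow> 0"
    by (auto dest: filterlim_compose)
  show "\<forall>\<^sub>F k in sequentially. norm (zudilin_cert m (real (Suc k))) \<le> \<bar>f (real (Suc k))\<bar>"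
  proof (intro always_eventually allI)
    fix k
    define t where "t = real (Suc k)"
    have "t > 0" by (simp add: t_def)
    have "norm (zudilin_cert m t) = \<bar>n\<^sup>2 * (t - n) * zudilin_poly n t / (t + n) ^ 5\<bar> * \<bar>ball_core m t\<bar>"
      by (simp add: zudilin_cert_def n_def abs_mult diff_diff_eq add.assoc)
    also have "\<dots> \<le> \<bar>n\<^sup>2 * (t - n) * zudilin_poly n t / (t + n) ^ 5\<bar> * (1 / t ^ 4)"
      using abs_ball_core_le[of m k] by (intro mult_left_mono) (simp_all add: t_def)
    also have "\<dots> = \<bar>n\<^sup>2 * (t - n) * zudilin_poly n t / (t + n) ^ 5 * (1 / t ^ 4)\<bar>"
      by (simp add: abs_mult)
    also have "n\<^sup>2 * (t - n) * zudilin_poly n t / (t + n) ^ 5 * (1 / t ^ 4) = f t"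
      using \<open>t > 0\<close> by (simp add: f_def eval_nat_numeral)
    finally show "norm (zudilin_cert m (real (Suc k))) \<le> \<bar>f (real (Suc k))\<bar>"
      by (simp only: t_def)
  qed
qed

lemma apery_solution_ball_sum: "apery_solution ball_sum"
  unfolding apery_solution_def
proof
  fix m
  let ?f = "\<lambda>k. zudilin_cert m (real (Suc (Suc k))) - zudilin_cert m (real (Suc k))"
  have "?f sums (0 - zudilin_cert m (real (Suc 0)))"
    by (rule telescope_sums[OF zudilin_cert_tendsto_0])
  then have "?f sums 0" by (simp add: zudilin_cert_1)
  moreover have "?f k = (real m + 2) ^ 3 * ball_term (m + 2) k
      - apery_coeff (real m + 1) * ball_term (m + 1) k + (real m + 1) ^ 3 * ball_term m k" for k
    using zudilin_cert_diff[of "real (Suc k)" m]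
    by (simp add: ball_term_def add_ac)
  then have "?f sums ((real m + 2) ^ 3 * ball_sum (m + 2)
      - apery_coeff (real m + 1) * ball_sum (m + 1) + (real m + 1) ^ 3 * ball_sum m)"
    by (simp only:) (intro sums_add sums_diff sums_mult ball_term_sums)
  ultimately have "0 = (real m + 2) ^ 3 * ball_sum (m + 2)
      - apery_coeff (real m + 1) * ball_sum (m + 1) + (real m + 1) ^ 3 * ball_sum m"
    by (rule sums_unique2)
  then show "(real m + 2) ^ 3 * ball_sum (m + 2)
      = apery_coeff (real m + 1) * ball_sum (m + 1) - (real m + 1) ^ 3 * ball_sum m" by linarith
qed

lemma ball_sum_eq: "ball_sum n = 2 * zeta3 * apery_den n - apery_num n"
proof (rule apery_solution_unique[OF apery_solution_ball_sum])
  show "apery_solution (\<lambda>n. 2 * zeta3 * apery_den n - apery_num n)"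
    by (intro apery_solution_mult_diff apery_solution_den apery_solution_num)
qed (simp_all only: ball_sum_0 ball_sum_1 apery_den_simps apery_num_simps)

section \<open>Combinations of consecutive terms\<close>

definition consec_comb :: "real \<Rightarrow> (nat \<Rightarrow> real) \<Rightarrow> nat \<Rightarrow> real" where
  "consec_comb s U n = U (n + 1) + s * U n"

lemma consec_comb_den_simps:
  "consec_comb s apery_den 0 = 5 + s" "consec_comb s apery_den 1 = 73 + 5 * s"
  using apery_den_simps by (simp_all add: consec_comb_def numeral_2_eq_2)

lemma consec_comb_num_simps:
  "consec_comb s apery_num 0 = 12" "consec_comb s apery_num 1 = 351 / 2 + 12 * s"
  using apery_num_simps by (simp_all add: consec_comb_def numeral_2_eq_2)

lemma consec_comb_den_ge:
  assumes "\<bar>s\<bar> \<le> 5"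
  shows "(5 - \<bar>s\<bar>) * 5 ^ n \<le> consec_comb s apery_den n"
proof -
  have "(5 - \<bar>s\<bar>) * 5 ^ n \<le> (5 - \<bar>s\<bar>) * apery_den n"
    using assms apery_den_ge_power by (intro mult_left_mono) auto
  also have "\<dots> \<le> (5 + s) * apery_den n"
    using apery_den_growth(1)[of n] by (intro mult_right_mono) auto
  also have "\<dots> \<le> consec_comb s apery_den n"
    using apery_den_growth(2)[of n] by (simp add: consec_comb_def distrib_right)
  finally show ?thesis .
qed

lemma consec_comb_den_pos:
  assumes "\<bar>s\<bar> < 5"
  shows "consec_comb s apery_den n > 0"
proof (rule less_le_trans)
  show "0 < (5 - \<bar>s\<bar>) * 5 ^ n" using assms by simp
qed (use assms in \<open>simp add: consec_comb_den_ge\<close>)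

lemma abs_consec_comb_ball_sum_le: "\<bar>consec_comb s ball_sum n\<bar> \<le> 3 * zeta3 * (1 + \<bar>s\<bar>)"
proof -
  have "\<bar>consec_comb s ball_sum n\<bar> \<le> \<bar>ball_sum (n + 1)\<bar> + \<bar>s\<bar> * \<bar>ball_sum n\<bar>"
    using abs_triangle_ineq[of "ball_sum (n + 1)" "s * ball_sum n"]
    by (simp add: consec_comb_def abs_mult)
  also have "\<dots> \<le> 3 * zeta3 + \<bar>s\<bar> * (3 * zeta3)"
    by (intro add_mono mult_left_mono abs_ball_sum_le abs_ge_zero)
  also have "\<dots> = 3 * zeta3 * (1 + \<bar>s\<bar>)" by algebra
  finally show ?thesis .
qed

lemma consec_comb_quotient_tendsto:
  assumes "\<bar>s\<bar> < 5"
  shows "(\<lambda>n. consec_comb s apery_num n / consec_comb s apery_den n) \<longlonglongrightarrow> 2 * zeta3"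
proof -
  let ?D = "consec_comb s apery_den" and ?R = "consec_comb s ball_sum"
  have quot: "consec_comb s apery_num n / ?D n = 2 * zeta3 - ?R n / ?D n" for n
  proof -
    have "consec_comb s apery_num n = 2 * zeta3 * ?D n - ?R n"
      by (simp add: consec_comb_def ball_sum_eq algebra_simps)
    then show ?thesis
      using consec_comb_den_pos[OF assms, of n] by (simp add: diff_divide_distrib)
  qed
  have "(\<lambda>n. ?R n / ?D n) \<longlonglongrightarrow> 0"
  proof (rule Lim_null_comparison)
    show "\<forall>\<^sub>F n in sequentially. norm (?R n / ?D n) \<le> 3 * zeta3 * (1 + \<bar>s\<bar>) / ((5 - \<bar>s\<bar>) * 5 ^ n)"
    proof (intro always_eventually allI)
      fix n
      show "norm (?R n / ?D n) \<le> 3 * zeta3 * (1 + \<bar>s\<bar>) / ((5 - \<bar>s\<bar>) * 5 ^ n)"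
        using assms abs_consec_comb_ball_sum_le[of s n] consec_comb_den_ge[of s n] consec_comb_den_pos[OF assms, of n]
        by (simp only: real_norm_def abs_divide, intro frac_le) auto
    qed
    show "(\<lambda>n. 3 * zeta3 * (1 + \<bar>s\<bar>) / ((5 - \<bar>s\<bar>) * 5 ^ n)) \<longlonglongrightarrow> 0"
      using assms by real_asymp
  qed
  from tendsto_diff[OF tendsto_const this, of "2 * zeta3"] show ?thesis
    unfolding quot by simp
qed

\<comment> \<open>
  Up to powers of \<open>s\<close> and a common factor, the only multipliers with which the recurrences of \<open>U\<close> at
  two consecutive indices combine to a recurrence between the terms \<open>U\<^bsub>n+1\<^esub> + s U\<^bsub>n\<^esub>\<close>.
\<close>
definition apery_weight :: "real \<Rightarrow> real \<Rightarrow> real" where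
  "apery_weight s x = x ^ 3 + s\<^sup>2 * (x + 1) ^ 3 + s * apery_coeff x"

lemma apery_weight_plus_1: "apery_weight 1 x = 6 * (2 * x + 1) * ((x + 1) ^ 3 - x ^ 3)"
  unfolding apery_weight_def apery_coeff_def by (simp, algebra)

lemma apery_weight_minus_1: "apery_weight (-1) x = - 4 * (2 * x + 1) ^ 3"
  unfolding apery_weight_def apery_coeff_def by algebra

definition apery_partial_den :: "real \<Rightarrow> real \<Rightarrow> real" where
  "apery_partial_den s x = apery_weight s (x - 1) * (s * (x + 1) ^ 3 + apery_coeff x)
     - s * apery_weight s x * x ^ 3"

lemma consec_comb_recurrence:
  fixes n :: nat
  assumes U: "apery_solution U"
  defines "x \<equiv> real n"
  shows "apery_weight s (x + 1) * (x + 3) ^ 3 * consec_comb s U (n + 2)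
    = apery_partial_den s (x + 2) * consec_comb s U (n + 1)
      - apery_weight s (x + 2) * (x + 1) ^ 3 * consec_comb s U n"
proof -
  define k1 k2 k3 where "k1 = (x + 1) ^ 3" and "k2 = (x + 2) ^ 3" and "k3 = (x + 3) ^ 3"
  define A1 A2 where "A1 = apery_coeff (x + 1)" and "A2 = apery_coeff (x + 2)"
  define U0 U1 U2 U3 where "U0 = U n" and "U1 = U (n + 1)" and "U2 = U (n + 2)" and "U3 = U (n + 3)"
  have rec: "k2 * U2 = A1 * U1 - k1 * U0" "k3 * U3 = A2 * U2 - k2 * U1"
    using apery_solutionD[OF U, of n] apery_solutionD[OF U, of "n + 1"]
    by (simp_all add: x_def k1_def k2_def k3_def A1_def A2_def U0_def U1_def U2_def U3_def
        add_ac numeral_3_eq_3)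
  define w1 w2 where "w1 = k1 + s\<^sup>2 * k2 + s * A1" and "w2 = k2 + s\<^sup>2 * k3 + s * A2"
  have weights: "apery_weight s (x + 1) = w1" "apery_weight s (x + 2) = w2"
    by (simp_all add: apery_weight_def w1_def w2_def k1_def k2_def k3_def A1_def A2_def add_ac)
  have shift: "x + 2 - 1 = x + 1" "x + 2 + 1 = x + 3" by simp_all
  have partial_den: "apery_partial_den s (x + 2) = w1 * (s * k3 + A2) - s * w2 * k2"
    unfolding apery_partial_den_def shift by (simp only: weights k2_def k3_def A2_def)
  have "w1 * k3 * (U3 + s * U2)
      - ((w1 * (s * k3 + A2) - s * w2 * k2) * (U2 + s * U1) - w2 * k1 * (U1 + s * U0))
    = w1 * (k3 * U3 - (A2 * U2 - k2 * U1)) + s * w2 * (k2 * U2 - (A1 * U1 - k1 * U0))"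
    unfolding w1_def w2_def by algebra
  also have "\<dots> = 0" using rec by simp
  finally have "w1 * k3 * (U3 + s * U2)
      = (w1 * (s * k3 + A2) - s * w2 * k2) * (U2 + s * U1) - w2 * k1 * (U1 + s * U0)"
    by (simp only: right_minus_eq)
  then show ?thesis
    unfolding weights partial_den
    by (simp add: consec_comb_def k1_def k2_def k3_def A2_def U0_def U1_def U2_def U3_def numeral_3_eq_3)
qed

lemma apery_weight_0: "apery_weight s 0 = s * (5 + s)"
  by (simp add: apery_weight_def apery_coeff_def power2_eq_square algebra_simps)

lemma apery_partial_den_1: "apery_partial_den s 1 = 8 * s * (73 + 5 * s)"
  unfolding apery_partial_den_def apery_weight_def apery_coeff_def by (simp, algebra)

lemma has_cf_value_apery:
  assumes s: "\<bar>s\<bar> < 5" and r: "r \<noteq> 0" and weight: "\<And>n. apery_weight s (real n) \<noteq> 0"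
    and b0: "b 0 * (5 + s) = 12"
    and b: "\<And>\<nu>. \<nu> \<ge> 1 \<Longrightarrow> b \<nu> = r * apery_partial_den s (real \<nu>)"
    and a1: "a 1 * (5 + s) = 12 * r * s * apery_weight s 1"
    and a: "\<And>\<nu>. \<nu> \<ge> 2 \<Longrightarrow> a \<nu> = - (r\<^sup>2 * (real \<nu> - 1) ^ 3 * real \<nu> ^ 3
      * apery_weight s (real \<nu> - 2) * apery_weight s (real \<nu>))"
  shows "has_cf_value b a (2 * zeta3)"
proof -
  define p where "p n = r * (apery_weight s (real n) * (real n + 2) ^ 3)" for n
  define q where "q n = r * (apery_weight s (real n + 2) * (real n + 1) ^ 3)" for n
  have rec: "p (n + 1) * consec_comb s U (n + 2)
      = b (n + 2) * consec_comb s U (n + 1) - q n * consec_comb s U n"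
    if "apery_solution U" for U n
  proof -
    have "p (n + 1) = r * (apery_weight s (real n + 1) * (real n + 3) ^ 3)"
      "b (n + 2) = r * apery_partial_den s (real n + 2)"
      by (simp_all add: p_def b add_ac)
    then show ?thesis
      using consec_comb_recurrence[OF that, of s n] unfolding q_def by algebra
  qed
  have p0: "p 0 = 8 * r * s * (5 + s)" and b1: "b 1 = 8 * r * s * (73 + 5 * s)"
    by (simp_all add: p_def b apery_weight_0 apery_partial_den_1)
  have a1_eq: "a 1 * (5 + s) = 12 * r * s * (1 + 8 * s\<^sup>2 + 117 * s)"
    using a1 by (simp add: apery_weight_def apery_coeff_def)
  show ?thesis
  proof (rule has_cf_value_rescaled[OF rec[OF apery_solution_num] rec[OF apery_solution_den]])
    show "a (n + 2) = - (p n * q n)" for n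
      by (simp add: a p_def q_def power2_eq_square mult_ac add_ac)
    show "consec_comb s apery_num 0 = b 0 * consec_comb s apery_den 0"
      unfolding consec_comb_num_simps consec_comb_den_simps using b0 by simp
    show "p 0 * consec_comb s apery_den 1 = b 1 * consec_comb s apery_den 0"
      unfolding p0 b1 consec_comb_den_simps by algebra
    show "p 0 * consec_comb s apery_num 1 = b 1 * consec_comb s apery_num 0 + a 1 * consec_comb s apery_den 0"
      unfolding p0 b1 consec_comb_num_simps consec_comb_den_simps a1_eq
      by (simp add: field_simps power2_eq_square)
    show "p n \<noteq> 0" for n
      using r weight[of n] by (simp add: p_def add_eq_0_iff)
    show "consec_comb s apery_den n \<noteq> 0" for n
      using consec_comb_den_pos[OF s, of n] by simp
  qed (rule consec_comb_quotient_tendsto[OF s])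
qed

lemma has_cf_value_b1_a1: "has_cf_value b1 a1 (2 * zeta3)"
proof (rule has_cf_value_apery[where s = "-1" and r = "-1/4"])
  show "apery_weight (-1) (real n) \<noteq> 0" for n
    by (simp add: apery_weight_minus_1 add_eq_0_iff)
  show "b1 \<nu> = -1/4 * apery_partial_den (-1) (real \<nu>)" if "\<nu> \<ge> 1" for \<nu>
    using that unfolding apery_partial_den_def apery_weight_minus_1 apery_coeff_def
    by (simp add: b1_def) algebra
  show "a1 \<nu> = - ((-1/4)\<^sup>2 * (real \<nu> - 1) ^ 3 * real \<nu> ^ 3
      * apery_weight (-1) (real \<nu> - 2) * apery_weight (-1) (real \<nu>))" if "\<nu> \<ge> 2" for \<nu>
    using that unfolding apery_weight_minus_1 by (simp add: a1_def) algebra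
qed (simp_all add: a1_def b1_def apery_weight_minus_1)

lemma has_cf_value_b2_a2: "has_cf_value b2 a2 (2 * zeta3)"
proof (rule has_cf_value_apery[where s = 1 and r = "1/6"])
  show "apery_weight 1 (real n) \<noteq> 0" for n
  proof -
    have "real n ^ 3 < (real n + 1) ^ 3" by (intro power_strict_mono) auto
    then show ?thesis by (simp add: apery_weight_plus_1 add_eq_0_iff)
  qed
  show "b2 \<nu> = 1/6 * apery_partial_den 1 (real \<nu>)" if "\<nu> \<ge> 1" for \<nu>
    using that unfolding apery_partial_den_def apery_weight_plus_1 apery_coeff_def
    by (simp add: b2_def) algebra
  show "a2 \<nu> = - ((1/6)\<^sup>2 * (real \<nu> - 1) ^ 3 * real \<nu> ^ 3
      * apery_weight 1 (real \<nu> - 2) * apery_weight 1 (real \<nu>))" if "\<nu> \<ge> 2" for \<nu>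
    using that unfolding apery_weight_plus_1 by (simp add: a2_def) algebra
qed (simp_all add: a2_def b2_def apery_weight_plus_1)

theorem theoremA:
  shows "has_cf_value b1 a1 (2 * zeta3) \<and> has_cf_value b2 a2 (2 * zeta3)"
  using has_cf_value_b1_a1 has_cf_value_b2_a2 by (rule conjI)

end
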